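(* Let $H$ be a real Hilbert space, $I=\{1,\dots,m\}$, and for each $i\in I$ let $T_i:H\to H$ be an $\alpha_i$-relaxed cutter with $\alpha_i\in(0,2)$, such that $\bigcap_{i\in I}\operatorname{Fix}T_i\neq\emptyset$. Let $I^t=(i^t_1,\dots,i^t_{m_t})$, $t=1,\dots,E$, be strings with $\bigcup_{t=1}^E I^t=I$, let $\omega_t>0$ with $\sum_{t=1}^E\omega_t=1$, and let $U_t=T_{i^t_{m_t}}\cdots T_{i^t_1}$ and $T=\sum_{t=1}^E\omega_tU_t$. Let $\sigma=\sigma_{\max}$ be the step size function defined in the context, let $\varepsilon\in(0,1)$, and let $\lambda_k\in[\varepsilon,2-\varepsilon]$ for all $k\ge0$. For arbitrary $x^0\in H$ define $$x^{k+1}=x^k+\lambda_k\sigma(x^k)\,(T(x^k)-x^k),\qquad k\ge0.$$ Then the sequence $\{x^k\}$ converges weakly to a point in $\operatorname{Fix}T$ if one of the following conditions is satisfied: (i) $T-\mathrm{Id}$ is demi-closed at $0$; or (ii) $U_t-\mathrm{Id}$ is demi-closed at $0$ for all $t=1,\dots,E$; or (iii) $T_i-\mathrm{Id}$ is demi-closed at $0$ for all $i=1,\dots,m$.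
   Context: $\operatorname{Fix}T=\{x\in H: T(x)=x\}$ and $\mathrm{Id}$ is the identity on $H$. For $\alpha\in[0,2]$, an operator $T:H\to H$ with $\operatorname{Fix}T\neq\emptyset$ is an $\alpha$-relaxed cutter if $\alpha\langle T(x)-x,z-x\rangle\ge\|T(x)-x\|^2$ for all $x\in H$ and all $z\in\operatorname{Fix}T$. An operator $F:H\to H$ is demi-closed at $0$ if, for every sequence $x^k$ converging weakly to some $y\in H$ with $F(x^k)\to0$ in norm, one has $F(y)=0$. A string $I^t=(i^t_1,\dots,i^t_{m_t})$ is an ordered subset of $I=\{1,\dots,m\}$. Put $S^t_0=\mathrm{Id}$, $S^t_j=T_{i^t_j}\cdots T_{i^t_1}$ and $\zeta^t_j(x)=S^t_j(x)-S^t_{j-1}(x)$. The step size function $\sigma_{\max}:H\to(0,\infty)$ is $$\sigma_{\max}(x)=\frac{\sum_{t=1}^E\omega_t\sum_{j=1}^{m_t}\big\langle U_t(x)-S^t_j(x)+\frac{1}{\alpha_{i^t_j}}\zeta^t_j(x),\ \zeta^t_j(x)\big\rangle}{\|T(x)-x\|^2}\ \text{ for }x\in H\setminus\operatorname{Fix}T,$$ and $\sigma_{\max}(x)=1$ for $x\in\operatorname{Fix}T$. *)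

theory Defs
  imports "HOL-Analysis.Analysis"
begin

definition Fix :: "('a \<Rightarrow> 'a) \<Rightarrow> 'a set"
  where "Fix F = {x. F x = x}"

definition relaxed_cutter :: "real \<Rightarrow> ('a::real_inner \<Rightarrow> 'a) \<Rightarrow> bool"
  where "relaxed_cutter \<alpha> F \<longleftrightarrow>
    0 \<le> \<alpha> \<and> \<alpha> \<le> 2 \<and> Fix F \<noteq> {} \<and>
    (\<forall>x. \<forall>z\<in>Fix F. \<alpha> * inner (F x - x) (z - x) \<ge> (norm (F x - x))\<^sup>2)"

text \<open>Weak convergence in a Hilbert space: by the Riesz representation theorem the continuous
  linear functionals are exactly the maps \<open>v \<mapsto> inner v h\<close>.\<close>

definition weakly_converges :: "(nat \<Rightarrow> 'a::real_inner) \<Rightarrow> 'a \<Rightarrow> bool"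
  where "weakly_converges u y \<longleftrightarrow> (\<forall>h. (\<lambda>k. inner (u k) h) \<longlonglongrightarrow> inner y h)"

definition demiclosed_at_0 :: "('a::real_inner \<Rightarrow> 'a) \<Rightarrow> bool"
  where "demiclosed_at_0 F \<longleftrightarrow>
    (\<forall>u y. weakly_converges u y \<longrightarrow> (\<lambda>k. F (u k)) \<longlonglongrightarrow> 0 \<longrightarrow> F y = 0)"

text \<open>An ordered subset \<open>(i\<^sub>1, \<dots>, i\<^sub>n)\<close> of an index set is a duplicate-free list \<open>s\<close>, with
  \<open>i\<^sub>j = s ! (j - 1)\<close>.  As \<open>fold\<close> runs through the list from the left,
  \<open>string_partial Ts s j\<close> is the composition in which \<open>Ts i\<^sub>1\<close> is applied first
  and \<open>Ts i\<^sub>j\<close> last.\<close>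

definition string_partial :: "('i \<Rightarrow> 'a \<Rightarrow> 'a) \<Rightarrow> 'i list \<Rightarrow> nat \<Rightarrow> 'a \<Rightarrow> 'a"
  where "string_partial Ts s j = fold Ts (take j s)"

definition string_op :: "('i \<Rightarrow> 'a \<Rightarrow> 'a) \<Rightarrow> 'i list \<Rightarrow> 'a \<Rightarrow> 'a"
  where "string_op Ts s = string_partial Ts s (length s)"

text \<open>Only meant for \<open>1 \<le> j \<le> length s\<close>.\<close>

definition string_step :: "('i \<Rightarrow> 'a \<Rightarrow> 'a) \<Rightarrow> 'i list \<Rightarrow> nat \<Rightarrow> 'a::real_vector \<Rightarrow> 'a"
  where "string_step Ts s j x = string_partial Ts s j x - string_partial Ts s (j - 1) x"

definition string_average ::
    "('i \<Rightarrow> 'a \<Rightarrow> 'a) \<Rightarrow> (nat \<Rightarrow> 'i list) \<Rightarrow> (nat \<Rightarrow> real) \<Rightarrow> nat \<Rightarrow> 'a::real_vector \<Rightarrow> 'a"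
  where "string_average Ts str \<omega> E x = (\<Sum>t=1..E. \<omega> t *\<^sub>R string_op Ts (str t) x)"

definition sigma_max ::
    "('i \<Rightarrow> 'a \<Rightarrow> 'a) \<Rightarrow> ('i \<Rightarrow> real) \<Rightarrow> (nat \<Rightarrow> 'i list) \<Rightarrow> (nat \<Rightarrow> real) \<Rightarrow> nat
      \<Rightarrow> 'a::real_inner \<Rightarrow> real"
  where "sigma_max Ts \<alpha> str \<omega> E x =
    (if x \<in> Fix (string_average Ts str \<omega> E) then 1
     else (\<Sum>t=1..E. \<omega> t * (\<Sum>j=1..length (str t).
             inner (string_op Ts (str t) x - string_partial Ts (str t) j x
                      + (1 / \<alpha> (str t ! (j - 1))) *\<^sub>R string_step Ts (str t) j x)
                   (string_step Ts (str t) j x)))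
          / (norm (string_average Ts str \<omega> E x - x))\<^sup>2)"

end

theory Submission
  imports Defs
begin

text \<open>Write \<open>A(x)\<close> for the numerator of \<open>\<sigma>\<^sub>m\<^sub>a\<^sub>x(x)\<close>. Telescoping along each string turns it into
  \<open>A(x) = \<Sum>\<^sub>t \<omega>\<^sub>t (\<parallel>U\<^sub>t x - x\<parallel>\<^sup>2 / 2 + \<Sum>\<^sub>j (1 / \<alpha>\<^sub>j - 1 / 2) \<parallel>\<zeta>\<^sub>j\<parallel>\<^sup>2)\<close>, and the cutter inequalities give
  \<open>A(x) \<le> \<langle>z - x, T x - x\<rangle>\<close> for every common fixed point \<open>z\<close>. Hence \<open>\<sigma>\<^sub>m\<^sub>a\<^sub>x \<ge> 1 / 2\<close> and the
  extrapolated operator is itself a cutter, so the iteration is Fejer monotone and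
  \<open>A(x\<^sub>k) \<rightarrow> 0\<close>. This forces \<open>T x\<^sub>k - x\<^sub>k\<close>, \<open>U\<^sub>t x\<^sub>k - x\<^sub>k\<close> and every \<open>\<zeta>\<^sub>j(x\<^sub>k)\<close> to tend to \<open>0\<close>, so
  under each of the three conditions the weak cluster points are fixed points of \<open>T\<close>, and
  Opial's argument yields weak convergence.\<close>

section \<open>Weak sequential compactness of bounded sequences\<close>

text \<open>The representing vector is the limit of a minimizing sequence of
  \<open>\<parallel>v\<parallel>\<^sup>2 - 2 L(v)\<close> on \<open>V\<close>. Applied to \<open>L = inner h\<close> this is the orthogonal projection onto
  \<open>closure V\<close>.\<close>

lemma riesz_on_subspace:
  fixes V :: "'h::{real_inner, complete_space} set" and L :: "'h \<Rightarrow> real"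
  assumes V: "subspace V"
    and add: "\<And>u v. u \<in> V \<Longrightarrow> v \<in> V \<Longrightarrow> L (u + v) = L u + L v"
    and scale: "\<And>c v. v \<in> V \<Longrightarrow> L (c *\<^sub>R v) = c * L v"
    and bounded: "\<And>v. v \<in> V \<Longrightarrow> \<bar>L v\<bar> \<le> B * norm v"
  shows "\<exists>y\<in>closure V. \<forall>v\<in>V. L v = inner y v"
proof -
  define f where "f = (\<lambda>v. (norm v)\<^sup>2 - 2 * L v)"
  define d where "d = Inf (f ` V)"
  have f_ge: "f v \<ge> - B\<^sup>2" if "v \<in> V" for v
  proof -
    have "0 \<le> (norm v - B)\<^sup>2" by simp
    also have "\<dots> = (norm v)\<^sup>2 - 2 * (B * norm v) + B\<^sup>2" by (simp add: power2_diff)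
    finally show ?thesis using bounded[OF that] unfolding f_def by linarith
  qed
  have bdd: "bdd_below (f ` V)" using f_ge by (intro bdd_belowI2)
  have d_le: "d \<le> f v" if "v \<in> V" for v
    unfolding d_def using bdd that by (intro cInf_lower) auto
  have ne: "f ` V \<noteq> {}" using subspace_0[OF V] by auto
  have "\<exists>v\<in>V. f v < d + 1 / real (Suc n)" for n
  proof -
    have "Inf (f ` V) < d + 1 / real (Suc n)" unfolding d_def by simp
    then show ?thesis using cInf_lessD[OF ne] by blast
  qed
  then obtain v where v: "\<And>n. v n \<in> V" "\<And>n. f (v n) < d + 1 / real (Suc n)" by metis
  \<comment> \<open>The parallelogram law at the midpoint \<open>c\<close>, which lies in
    \<open>V\<close> and hence has \<open>f c\<close> at least \<open>d\<close>. Since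
    \<open>L\<close> is linear, its contributions cancel and only values of \<open>f\<close> remain,
    so minimizing sequences are Cauchy.\<close>
  have gap: "(norm (a - b))\<^sup>2 \<le> 2 * (f a + f b - 2 * d)" if "a \<in> V" "b \<in> V" for a b
  proof -
    define c where "c = (1/2) *\<^sub>R (a + b)"
    have c: "c \<in> V" unfolding c_def by (simp add: V subspace_add subspace_scale that)
    have Lc: "L c = (L a + L b) / 2"
      unfolding c_def by (simp add: scale add V subspace_add that)
    have "(norm c)\<^sup>2 = (norm (a + b))\<^sup>2 / 4"
      unfolding c_def by (simp add: power_mult_distrib power2_eq_square)
    then have "(norm (a - b))\<^sup>2 = 2 * (f a + f b - 2 * f c)"
      unfolding f_def Lc by (simp add: power2_norm_eq_inner algebra_simps inner_commute)
    then show ?thesis using d_le[OF c] by simp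
  qed
  have "Cauchy v"
  proof (rule CauchyI)
    fix e :: real assume "0 < e"
    then obtain M where M: "4 / e\<^sup>2 < real M" using reals_Archimedean2 by blast
    show "\<exists>M. \<forall>m\<ge>M. \<forall>n\<ge>M. norm (v m - v n) < e"
    proof (intro exI allI impI)
      fix m n assume mn: "M \<le> m" "M \<le> n"
      have *: "f (v k) < d + e\<^sup>2 / 4" if "M \<le> k" for k
      proof -
        have "4 / e\<^sup>2 < real (Suc k)" using M that by linarith
        then have "1 / real (Suc k) < e\<^sup>2 / 4" using \<open>0 < e\<close> by (simp add: field_simps)
        then show ?thesis using v(2)[of k] by linarith
      qed
      have "(norm (v m - v n))\<^sup>2 < e\<^sup>2"
        using gap[OF v(1) v(1), of m n] *[OF mn(1)] *[OF mn(2)]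
        by (simp add: field_simps)
      then show "norm (v m - v n) < e" using \<open>0 < e\<close> power2_less_imp_less by fastforce
    qed
  qed
  then obtain y where y: "v \<longlonglongrightarrow> y" using Cauchy_convergent convergent_def by blast
  have "y \<in> closure V" using y v(1) closure_sequential by blast
  moreover have "L w = inner y w" if w: "w \<in> V" for w
  proof -
    define D where "D = inner y w - L w"
    \<comment> \<open>This is the minimality of \<open>y\<close> in the direction \<open>w\<close>.
      As \<open>y\<close> is only known to lie in \<open>closure V\<close>, where nothing is assumed
      about \<open>L\<close>, the inequality is proved at \<open>v n\<close>, up to the error
      1/(n+1), and then passed to the limit.\<close>
    have quad: "0 \<le> t\<^sup>2 * (norm w)\<^sup>2 + 2 * t * D" for t
    proof -
      have "0 \<le> 1 / real (Suc n) + t\<^sup>2 * (norm w)\<^sup>2 + 2 * t * (inner (v n) w - L w)" for n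
      proof -
        have tw: "t *\<^sub>R w \<in> V" using V w by (simp add: subspace_scale)
        have "d \<le> f (v n + t *\<^sub>R w)" using d_le V v(1) tw by (simp add: subspace_add)
        also have "\<dots> = f (v n) + t\<^sup>2 * (norm w)\<^sup>2 + 2 * t * (inner (v n) w - L w)"
          unfolding f_def add[OF v(1) tw] scale[OF w]
          by (simp add: power2_norm_eq_inner algebra_simps inner_commute
            power2_eq_square[of t])
        finally show ?thesis using v(2)[of n] by linarith
      qed
      moreover have "(\<lambda>n. 1 / real (Suc n) + t\<^sup>2 * (norm w)\<^sup>2 + 2 * t * (inner (v n) w - L w))
          \<longlonglongrightarrow> 0 + t\<^sup>2 * (norm w)\<^sup>2 + 2 * t * (inner y w - L w)"
        using LIMSEQ_inverse_real_of_nat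
        by (intro tendsto_intros y) (simp add: divide_inverse)
      ultimately show ?thesis unfolding D_def
        by (metis (no_types, lifting) LIMSEQ_le_const add_0)
    qed
    have "D = 0"
    proof (cases "w = 0")
      case True
      then show ?thesis using scale[OF w, of 0] by (simp add: D_def)
    next
      case False
      define N where "N = (norm w)\<^sup>2"
      have N: "N > 0" using False by (simp add: N_def)
      \<comment> \<open>The quadratic in \<open>t\<close> is least at \<open>t = - D / N\<close>,
        where its value is \<open>- (D\<^sup>2 / N)\<close>.\<close>
      have "0 \<le> (- D / N)\<^sup>2 * N + 2 * (- D / N) * D" using quad unfolding N_def by blast
      also have "\<dots> = - (D\<^sup>2 / N)" using N by (simp add: power2_eq_square field_simps)
      finally have "D\<^sup>2 / N \<le> 0" by simp
      then show ?thesis using N by (simp add: divide_le_0_iff)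
    qed
    then show ?thesis by (simp add: D_def)
  qed
  ultimately show ?thesis by blast
qed

text \<open>Tychonoff's theorem in place of a diagonal argument: a countable product of compact
  intervals is compact and metrizable, hence sequentially compact, and convergence in it is
  coordinatewise.\<close>

lemma pointwise_convergent_subsequence:
  fixes g :: "nat \<Rightarrow> nat \<Rightarrow> real"
  assumes "\<And>n m. \<bar>g n m\<bar> \<le> B m"
  shows "\<exists>r. strict_mono r \<and> (\<forall>m. convergent (\<lambda>n. g (r n) m))"
proof -
  let ?K = "PiE UNIV (\<lambda>m. {- B m..B m})"
  have "compactin (product_topology (\<lambda>_. euclidean) UNIV) ?K"
    by (simp add: compactin_PiE compactin_euclidean_iff)
  then have "compact ?K"
    by (simp add: euclidean_product_topology compactin_euclidean_iff)
  then have "seq_compact ?K" by (simp add: compact_eq_seq_compact_metric)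
  moreover have "\<forall>n. g n \<in> ?K" using assms by (auto simp: abs_le_iff minus_le_iff)
  ultimately obtain l r where "strict_mono r" and lim: "(g \<circ> r) \<longlonglongrightarrow> l"
    using seq_compactE by metis
  have "(\<lambda>n. g (r n) m) \<longlonglongrightarrow> l m" for m
    using lim continuous_on_tendsto_compose[of UNIV "\<lambda>f. f m" "g \<circ> r" l sequentially]
    by (simp add: continuous_on_product_coordinates o_def)
  then show ?thesis using \<open>strict_mono r\<close> convergentI by blast
qed

text \<open>\<open>H\<close> need not be separable: it is enough to make the inner products with the sequence itself
  converge, since \<open>X n\<close> does not see the component of \<open>h\<close> orthogonal to its span.\<close>

lemma bounded_weakly_convergent_subsequence:
  fixes X :: "nat \<Rightarrow> 'h::{real_inner, complete_space}"
  assumes B: "\<And>n. norm (X n) \<le> B"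
  shows "\<exists>r y. strict_mono r \<and> weakly_converges (X \<circ> r) y"
proof -
  have "\<bar>inner (X n) (X m)\<bar> \<le> B * B" for n m
    using order_trans[OF Cauchy_Schwarz_ineq2 mult_mono[OF B B]] norm_ge_zero order_trans[OF _ B]
    by blast
  then obtain r where r: "strict_mono r" "\<And>m. convergent (\<lambda>n. inner (X (r n)) (X m))"
    using pointwise_convergent_subsequence[of "\<lambda>n m. inner (X n) (X m)" "\<lambda>_. B * B"] by auto
  define V where "V = span (range X)"
  define L where "L = (\<lambda>v. lim (\<lambda>n. inner (X (r n)) v))"
  \<comment> \<open>Convergence is so far known only against the terms \<open>X m\<close>. The
    vectors against which it holds form a subspace, so it extends to their span.\<close>
  have sub: "subspace {v. convergent (\<lambda>n. inner (X (r n)) v)}"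
    by (auto simp: subspace_def inner_add_right convergent_const
        intro: convergent_add convergent_mult)
  have "V \<subseteq> {v. convergent (\<lambda>n. inner (X (r n)) v)}"
    unfolding V_def by (rule span_minimal[OF _ sub]) (use r(2) in auto)
  then have lim: "(\<lambda>n. inner (X (r n)) v) \<longlonglongrightarrow> L v" if "v \<in> V" for v
    using that unfolding L_def by (auto simp: convergent_LIMSEQ_iff)
  have V: "subspace V" by (simp add: V_def)
  have "\<exists>y\<in>closure V. \<forall>v\<in>V. L v = inner y v"
  proof (rule riesz_on_subspace[OF V, where B=B])
    fix u v assume "u \<in> V" "v \<in> V"
    then show "L (u + v) = L u + L v"
      using lim[of u] lim[of v] lim[of "u + v"] V
      by (auto simp: inner_add_right subspace_add intro: LIMSEQ_unique tendsto_add)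
  next
    fix c v assume "v \<in> V"
    then show "L (c *\<^sub>R v) = c * L v"
      using lim[of v] lim[of "c *\<^sub>R v"] V
      by (auto simp: subspace_scale intro: LIMSEQ_unique tendsto_mult_left)
  next
    fix v assume "v \<in> V"
    have "\<bar>inner (X (r n)) v\<bar> \<le> B * norm v" for n
      using order_trans[OF Cauchy_Schwarz_ineq2 mult_right_mono[OF B]] by simp
    then show "\<bar>L v\<bar> \<le> B * norm v"
      using tendsto_rabs[OF lim[OF \<open>v \<in> V\<close>]] LIMSEQ_le_const2 by blast
  qed
  then obtain y where y: "y \<in> closure V" "\<And>v. v \<in> V \<Longrightarrow> L v = inner y v" by blast
  have on_V: "(\<lambda>n. inner (X (r n) - y) v) \<longlonglongrightarrow> 0" if "v \<in> V" for v
    using lim[OF that] y(2)[OF that] by (simp add: inner_diff_left LIM_zero)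
  define M where "M = B + norm y"
  have M: "norm (X (r n) - y) \<le> M" for n
    unfolding M_def using norm_triangle_ineq4[of "X (r n)" y] B[of "r n"] by linarith
  have on_closure: "(\<lambda>n. inner (X (r n) - y) p) \<longlonglongrightarrow> 0" if "p \<in> closure V" for p
  proof (rule LIMSEQ_I)
    fix e :: real assume "0 < e"
    have "0 \<le> M" using M norm_ge_zero order_trans by blast
    \<comment> \<open>Chosen so that \<open>M * \<delta>\<close> is at most \<open>e / 2\<close>;
      the added 1 keeps the denominator positive when \<open>M = 0\<close>.\<close>
    define \<delta> where "\<delta> = e / (2 * (M + 1))"
    have "0 < \<delta>" using \<open>0 < e\<close> \<open>0 \<le> M\<close> by (simp add: \<delta>_def)
    then obtain v where v: "v \<in> V" "dist v p < \<delta>"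
      using \<open>p \<in> closure V\<close> closure_approachable by blast
    obtain N where N: "\<And>n. n \<ge> N \<Longrightarrow> \<bar>inner (X (r n) - y) v\<bar> < e / 2"
      using LIMSEQ_D[OF on_V[OF v(1)], of "e / 2"] \<open>0 < e\<close> by auto
    have "\<bar>inner (X (r n) - y) p\<bar> < e" if "n \<ge> N" for n
    proof -
      have "\<bar>inner (X (r n) - y) (p - v)\<bar> \<le> norm (X (r n) - y) * norm (p - v)"
        by (rule Cauchy_Schwarz_ineq2)
      also have "\<dots> \<le> M * \<delta>"
        using M v(2) \<open>0 \<le> M\<close> by (intro mult_mono) (auto simp: dist_norm norm_minus_commute)
      also have "\<dots> \<le> e / 2" using \<open>0 \<le> M\<close> \<open>0 < e\<close> by (simp add: \<delta>_def field_simps)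
      finally have "\<bar>inner (X (r n) - y) p - inner (X (r n) - y) v\<bar> \<le> e / 2"
        by (simp only: inner_diff_right)
      then show ?thesis using N[OF that] by arith
    qed
    then show "\<exists>N. \<forall>n\<ge>N. norm (inner (X (r n) - y) p - 0) < e" by auto
  qed
  have "(\<lambda>n. inner ((X \<circ> r) n) h) \<longlonglongrightarrow> inner y h" for h
  proof -
    have "\<exists>p\<in>closure V. \<forall>v\<in>V. inner h v = inner p v"
      using V Cauchy_Schwarz_ineq2
      by (intro riesz_on_subspace[where B="norm h"]) (auto simp: inner_add_right)
    then obtain p where p: "p \<in> closure V" "\<And>v. v \<in> V \<Longrightarrow> inner h v = inner p v" by blast
    \<comment> \<open>Since \<open>h - p\<close> is orthogonal to \<open>V\<close>, it is orthogonal
      to the closure, which contains every \<open>X (r n)\<close> and also \<open>y\<close>. Testing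
      with \<open>h\<close> is therefore the same as testing with \<open>p\<close>.\<close>
    have "closure V \<subseteq> {v. inner (h - p) v = 0}"
      by (rule closure_minimal)
        (use p(2) in \<open>auto simp: inner_diff_left intro!: closed_Collect_eq continuous_intros\<close>)
    moreover have "X (r n) \<in> closure V" for n
      using closure_subset[of V] by (auto simp: V_def span_base)
    ultimately have "inner (h - p) (X (r n)) = 0" "inner (h - p) y = 0" for n
      using y(1) by blast+
    then have "inner (X (r n) - y) (h - p) = 0" for n
      by (simp only: inner_commute[of _ "h - p"] inner_diff_right[of _ "X (r n)"])
    then have "inner (X (r n) - y) h = inner (X (r n) - y) p" for n
      by (simp only: inner_diff_right right_minus_eq)
    then have "(\<lambda>n. inner (X (r n) - y) h) \<longlonglongrightarrow> 0" using on_closure[OF p(1)] by simp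
    then show ?thesis by (simp add: inner_diff_left LIM_zero_iff)
  qed
  then show ?thesis using r(1) unfolding weakly_converges_def by blast
qed

section \<open>Weak limits and Opial's argument\<close>

lemma weakly_converges_strongly_close:
  assumes "weakly_converges u y" "(\<lambda>k. v k - u k) \<longlonglongrightarrow> 0"
  shows "weakly_converges v y"
  unfolding weakly_converges_def
proof
  fix h
  have "(\<lambda>k. inner (u k) h + inner (v k - u k) h) \<longlonglongrightarrow> inner y h + inner 0 h"
    using assms(1) unfolding weakly_converges_def
    by (intro tendsto_add tendsto_inner[OF assms(2)]) auto
  then show "(\<lambda>k. inner (v k) h) \<longlonglongrightarrow> inner y h" by (simp add: inner_diff_left)
qed

text \<open>The distances to two cluster points y and y' both converge, so by polarization the inner
  products of \<open>x k\<close> with y' - y converge along the whole sequence. Comparing the limits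
  along the two subsequences forces y' = y. Boundedness then turns uniqueness of the cluster point
  into convergence.\<close>

lemma fejer_monotone_weakly_converges:
  fixes x :: "nat \<Rightarrow> 'h::{real_inner, complete_space}"
  assumes "F \<noteq> {}"
    and fejer: "\<And>z k. z \<in> F \<Longrightarrow> norm (x (Suc k) - z) \<le> norm (x k - z)"
    and cluster: "\<And>r y. strict_mono r \<Longrightarrow> weakly_converges (x \<circ> r) y \<Longrightarrow> y \<in> F"
  shows "\<exists>y\<in>F. weakly_converges x y"
proof -
  have decr: "decseq (\<lambda>k. norm (x k - z))" if "z \<in> F" for z
    using fejer[OF that] by (intro decseq_SucI)
  obtain z where z: "z \<in> F" using assms(1) by blast
  have bounded: "norm (x k) \<le> norm (x 0 - z) + norm z" for k
    using decseqD[OF decr[OF z], of 0 k] norm_triangle_ineq[of "x k - z" z] by simp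
  have subseq: "\<exists>r' y. strict_mono r' \<and> weakly_converges ((x \<circ> r) \<circ> r') y" for r :: "nat \<Rightarrow> nat"
    by (rule bounded_weakly_convergent_subsequence[where B="norm (x 0 - z) + norm z"])
      (use bounded in auto)
  obtain r y where r: "strict_mono r" "weakly_converges (x \<circ> r) y"
    using subseq[of id] by auto
  have y: "y \<in> F" using cluster r by blast
  have unique: "y' = y" if r': "strict_mono r'" "weakly_converges (x \<circ> r') y'" for r' y'
  proof -
    have y': "y' \<in> F" using cluster r' by blast
    have conv: "\<exists>l. (\<lambda>k. (norm (x k - w))\<^sup>2) \<longlonglongrightarrow> l" if "w \<in> F" for w
      using decseq_convergent[OF decr[OF that], of 0] by (metis norm_ge_zero tendsto_power)
    obtain l l' where "(\<lambda>k. (norm (x k - y))\<^sup>2) \<longlonglongrightarrow> l" "(\<lambda>k. (norm (x k - y'))\<^sup>2) \<longlonglongrightarrow> l'"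
      using conv y y' by blast
    then have "(\<lambda>k. ((norm (x k - y))\<^sup>2 - (norm (x k - y'))\<^sup>2 - (norm y)\<^sup>2 + (norm y')\<^sup>2) / 2)
        \<longlonglongrightarrow> (l - l' - (norm y)\<^sup>2 + (norm y')\<^sup>2) / 2"
      by (intro tendsto_intros) auto
    moreover have "(\<lambda>k. ((norm (x k - y))\<^sup>2 - (norm (x k - y'))\<^sup>2 - (norm y)\<^sup>2 + (norm y')\<^sup>2) / 2)
        = (\<lambda>k. inner (x k) (y' - y))"
      by (rule ext) (simp add: power2_norm_eq_inner field_simps inner_simps inner_commute)
    ultimately have "(\<lambda>k. inner (x k) (y' - y)) \<longlonglongrightarrow> (l - l' - (norm y)\<^sup>2 + (norm y')\<^sup>2) / 2"
      by simp
    from LIMSEQ_subseq_LIMSEQ[OF this r(1)] LIMSEQ_subseq_LIMSEQ[OF this r'(1)]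
    have "inner y (y' - y) = inner y' (y' - y)"
      using r(2) r'(2) unfolding weakly_converges_def
      by (metis (no_types, lifting) LIMSEQ_unique comp_apply ext)
    then have "inner (y' - y) (y' - y) = 0" by (simp add: inner_diff_left)
    then show ?thesis by simp
  qed
  \<comment> \<open>Otherwise some subsequence \<open>s\<close> keeps a distance \<open>e\<close>
    from the limit when tested with \<open>h\<close>; a weakly convergent subsequence of
    \<open>s\<close> must still tend to \<open>y\<close>, a contradiction.\<close>
  have "(\<lambda>k. inner (x k) h) \<longlonglongrightarrow> inner y h" for h
  proof (rule ccontr)
    assume "\<not> ?thesis"
    then obtain e where "0 < e" and "\<not> (\<forall>\<^sub>F k in sequentially. dist (inner (x k) h) (inner y h) < e)"
      unfolding tendsto_iff by blast
    then obtain s :: "nat \<Rightarrow> nat" where s: "strict_mono s"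
        "\<And>n. \<not> dist (inner (x (s n)) h) (inner y h) < e"
      using not_eventually_sequentiallyD by blast
    obtain s' y' where s': "strict_mono s'" "weakly_converges ((x \<circ> s) \<circ> s') y'"
      using subseq by blast
    have "y' = y"
      using unique[of "s \<circ> s'" y'] s(1) s' by (simp add: strict_mono_o comp_assoc)
    then have "(\<lambda>n. inner (x (s (s' n))) h) \<longlonglongrightarrow> inner y h"
      using s'(2) unfolding weakly_converges_def by simp
    then have "\<forall>\<^sub>F n in sequentially. dist (inner (x (s (s' n))) h) (inner y h) < e"
      using \<open>0 < e\<close> by (simp add: tendsto_iff)
    then show False using s(2) eventually_sequentially by auto
  qed
  then show ?thesis using y unfolding weakly_converges_def by blast
qed

section \<open>Estimates for a single string\<close>

text \<open>Polarization of each summand makes the distances to \<open>p\<close> telescope. It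
  serves twice: with \<open>p\<close> the end point of a string, where the last distance vanishes,
  and with \<open>p\<close> a common fixed point.\<close>

lemma sum_inner_steps:
  fixes S :: "nat \<Rightarrow> 'a::real_inner"
  shows "(\<Sum>j=1..n. inner (p - S j) (S j - S (j - 1)))
    = ((norm (p - S 0))\<^sup>2 - (norm (p - S n))\<^sup>2 - (\<Sum>j=1..n. (norm (S j - S (j - 1)))\<^sup>2)) / 2"
proof (induction n)
  case (Suc n)
  have "inner (p - S (Suc n)) (S (Suc n) - S n)
    = ((norm (p - S n))\<^sup>2 - (norm (p - S (Suc n)))\<^sup>2 - (norm (S (Suc n) - S n))\<^sup>2) / 2"
    by (simp add: power2_norm_eq_inner field_simps inner_simps inner_commute)
  then show ?case using Suc.IH by (simp add: field_simps)
qed simp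

text \<open>The difference of the two sides is the weighted variance of \<open>u\<close> about its
  mean \<open>v\<close>.\<close>

lemma norm_sq_weighted_sum_le:
  fixes u :: "'i \<Rightarrow> 'a::real_inner"
  assumes "\<And>t. t \<in> I \<Longrightarrow> 0 \<le> \<omega> t" "(\<Sum>t\<in>I. \<omega> t) = 1"
  shows "(norm (\<Sum>t\<in>I. \<omega> t *\<^sub>R u t))\<^sup>2 \<le> (\<Sum>t\<in>I. \<omega> t * (norm (u t))\<^sup>2)"
proof -
  define v where "v = (\<Sum>t\<in>I. \<omega> t *\<^sub>R u t)"
  have "0 \<le> (\<Sum>t\<in>I. \<omega> t * (norm (u t - v))\<^sup>2)"
    using assms(1) by (intro sum_nonneg) auto
  also have "\<dots> = (\<Sum>t\<in>I. \<omega> t * (norm (u t))\<^sup>2 - 2 * inner (\<omega> t *\<^sub>R u t) v + \<omega> t * (norm v)\<^sup>2)"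
    by (intro sum.cong)
      (simp_all add: power2_norm_eq_inner algebra_simps inner_simps inner_commute)
  also have "\<dots> = (\<Sum>t\<in>I. \<omega> t * (norm (u t))\<^sup>2) - 2 * inner v v + (norm v)\<^sup>2"
    by (simp add: sum.distrib sum_subtractf assms(2) v_def inner_sum_left
        flip: sum_distrib_left sum_distrib_right)
  finally show ?thesis by (simp add: v_def power2_norm_eq_inner)
qed

lemma string_partial_0: "string_partial Ts s 0 x = x"
  by (simp add: string_partial_def)

lemma string_partial_Suc:
  "j < length s \<Longrightarrow> string_partial Ts s (Suc j) x = Ts (s ! j) (string_partial Ts s j x)"
  by (simp add: string_partial_def take_Suc_conv_app_nth)

text \<open>The contribution of one string to the numerator of \<open>sigma_max\<close>, before
  weighting.\<close>

definition string_sum ::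
    "('i \<Rightarrow> 'a \<Rightarrow> 'a) \<Rightarrow> ('i \<Rightarrow> real) \<Rightarrow> 'i list \<Rightarrow> 'a::real_inner \<Rightarrow> real"
  where "string_sum Ts \<alpha> s x = (\<Sum>j=1..length s.
    inner (string_op Ts s x - string_partial Ts s j x
             + (1 / \<alpha> (s ! (j - 1))) *\<^sub>R string_step Ts s j x)
          (string_step Ts s j x))"

text \<open>The telescoped form is a sum of squares; for relaxation parameters strictly between 0
  and 2 all its coefficients are positive.\<close>

lemma string_sum_eq:
  "string_sum Ts \<alpha> s x = (norm (string_op Ts s x - x))\<^sup>2 / 2
    + (\<Sum>j=1..length s. (1 / \<alpha> (s ! (j - 1)) - 1 / 2) * (norm (string_step Ts s j x))\<^sup>2)"
proof -
  let ?S = "\<lambda>j. string_partial Ts s j x"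
  have "string_sum Ts \<alpha> s x = (\<Sum>j=1..length s. inner (string_op Ts s x - ?S j) (?S j - ?S (j - 1)))
      + (\<Sum>j=1..length s. 1 / \<alpha> (s ! (j - 1)) * (norm (string_step Ts s j x))\<^sup>2)"
    unfolding string_sum_def sum.distrib[symmetric] string_step_def
    by (intro sum.cong refl) (simp add: inner_add_left power2_norm_eq_inner)
  then show ?thesis
    unfolding sum_inner_steps[of _ ?S] left_diff_distrib sum_subtractf
    by (simp add: string_op_def string_partial_0 string_step_def field_simps
        flip: sum_divide_distrib)
qed

text \<open>The cutter inequality is applied at each intermediate point, with \<open>z\<close> as
  the fixed point, and the resulting bounds telescope to a difference of squared distances to
  \<open>z\<close>.\<close>

lemma string_sum_le_inner:
  assumes cutter: "\<And>i. i \<in> set s \<Longrightarrow> relaxed_cutter (\<alpha> i) (Ts i)"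
    and pos: "\<And>i. i \<in> set s \<Longrightarrow> 0 < \<alpha> i"
    and z: "\<And>i. i \<in> set s \<Longrightarrow> z \<in> Fix (Ts i)"
  shows "string_sum Ts \<alpha> s x \<le> inner (z - x) (string_op Ts s x - x)"
proof -
  let ?S = "\<lambda>j. string_partial Ts s j x"
  let ?\<zeta> = "\<lambda>j. string_step Ts s j x"
  have step: "(1 / \<alpha> (s ! (j - 1)) - 1 / 2) * (norm (?\<zeta> j))\<^sup>2
      \<le> inner (z - ?S j) (?S j - ?S (j - 1)) + (norm (?S j - ?S (j - 1)))\<^sup>2 / 2"
    if j: "j \<in> {1..length s}" for j
  proof -
    define i where "i = s ! (j - 1)"
    have i: "i \<in> set s" using j unfolding i_def by (intro nth_mem) auto
    have Sj: "?S j = Ts i (?S (j - 1))"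
      using j unfolding i_def by (cases j) (simp_all add: string_partial_Suc)
    have "(norm (?\<zeta> j))\<^sup>2 \<le> \<alpha> i * inner (?\<zeta> j) (z - ?S (j - 1))"
      using cutter[OF i] z[OF i] unfolding relaxed_cutter_def string_step_def Sj by blast
    then have "1 / \<alpha> i * (norm (?\<zeta> j))\<^sup>2 \<le> inner (?\<zeta> j) (z - ?S (j - 1))"
      using pos[OF i] by (simp add: field_simps)
    \<comment> \<open>Moving the base point from the start to the end of the step costs one squared
      step length; half of it is cancelled by the 1/2 in the coefficient, the other half by
      \<open>sum_inner_steps\<close>.\<close>
    also have "\<dots> = inner (z - ?S j) (?\<zeta> j) + (norm (?\<zeta> j))\<^sup>2"
      unfolding string_step_def
      by (simp add: power2_norm_eq_inner inner_simps inner_commute)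
    finally show ?thesis unfolding i_def string_step_def by (simp add: field_simps)
  qed
  have "(\<Sum>j=1..length s. (1 / \<alpha> (s ! (j - 1)) - 1 / 2) * (norm (?\<zeta> j))\<^sup>2)
      \<le> (\<Sum>j=1..length s. inner (z - ?S j) (?S j - ?S (j - 1)) + (norm (?S j - ?S (j - 1)))\<^sup>2 / 2)"
    by (rule sum_mono) (rule step)
  also have "\<dots> = ((norm (z - x))\<^sup>2 - (norm (z - string_op Ts s x))\<^sup>2) / 2"
    unfolding sum.distrib sum_inner_steps[of _ ?S]
    by (simp add: string_op_def string_partial_0 field_simps flip: sum_divide_distrib)
  also have "\<dots> = inner (z - x) (string_op Ts s x - x) - (norm (string_op Ts s x - x))\<^sup>2 / 2"
    by (simp add: power2_norm_eq_inner field_simps inner_simps inner_commute)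
  finally show ?thesis unfolding string_sum_eq by simp
qed

lemma string_sum_lower_bounds:
  assumes \<alpha>: "\<And>i. i \<in> set s \<Longrightarrow> 0 < \<alpha> i \<and> \<alpha> i < 2"
  shows "(norm (string_op Ts s x - x))\<^sup>2 / 2 \<le> string_sum Ts \<alpha> s x"
    and "j \<in> {1..length s} \<Longrightarrow>
      (1 / \<alpha> (s ! (j - 1)) - 1 / 2) * (norm (string_step Ts s j x))\<^sup>2 \<le> string_sum Ts \<alpha> s x"
proof -
  let ?c = "\<lambda>j. (1 / \<alpha> (s ! (j - 1)) - 1 / 2) * (norm (string_step Ts s j x))\<^sup>2"
  have nonneg: "0 \<le> ?c j" if "j \<in> {1..length s}" for j
  proof -
    have "s ! (j - 1) \<in> set s" using that by (intro nth_mem) auto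
    then show ?thesis using \<alpha> by (intro mult_nonneg_nonneg) (auto simp: field_simps less_imp_le)
  qed
  have "0 \<le> (\<Sum>j=1..length s. ?c j)" by (rule sum_nonneg) (rule nonneg)
  then show "(norm (string_op Ts s x - x))\<^sup>2 / 2 \<le> string_sum Ts \<alpha> s x"
    unfolding string_sum_eq by simp
  assume "j \<in> {1..length s}"
  then have "?c j \<le> (\<Sum>j=1..length s. ?c j)" by (intro member_le_sum nonneg) auto
  then show "?c j \<le> string_sum Ts \<alpha> s x"
    unfolding string_sum_eq by (simp add: add_increasing)
qed

section \<open>The averaged operator and its extrapolated step\<close>

locale string_averaging =
  fixes Ts :: "'i \<Rightarrow> 'h::real_inner \<Rightarrow> 'h"
    and \<alpha> :: "'i \<Rightarrow> real"
    and I :: "'i set"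
    and E :: nat
    and str :: "nat \<Rightarrow> 'i list"
    and \<omega> :: "nat \<Rightarrow> real"
  assumes \<alpha>: "i \<in> I \<Longrightarrow> 0 < \<alpha> i \<and> \<alpha> i < 2"
    and cutter: "i \<in> I \<Longrightarrow> relaxed_cutter (\<alpha> i) (Ts i)"
    and strings: "(\<Union>t\<in>{1..E}. set (str t)) = I"
    and \<omega>_pos: "t \<in> {1..E} \<Longrightarrow> 0 < \<omega> t"
    and \<omega>_sum: "(\<Sum>t=1..E. \<omega> t) = 1"
    and common_fixed_point: "(\<Inter>i\<in>I. Fix (Ts i)) \<noteq> {}"
begin

abbreviation "U t \<equiv> string_op Ts (str t)"

abbreviation "T \<equiv> string_average Ts str \<omega> E"

abbreviation "\<sigma> \<equiv> sigma_max Ts \<alpha> str \<omega> E"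

text \<open>The numerator A(x) of \<open>sigma_max\<close>, kept apart from the quotient so that its
  estimates hold at fixed points of \<open>T\<close> as well.\<close>

definition total :: "'h \<Rightarrow> real"
  where "total x = (\<Sum>t=1..E. \<omega> t * string_sum Ts \<alpha> (str t) x)"

lemma \<omega>_nonneg: "t \<in> {1..E} \<Longrightarrow> 0 \<le> \<omega> t"
  using \<omega>_pos by (rule less_imp_le)

lemma mem_I: "t \<in> {1..E} \<Longrightarrow> i \<in> set (str t) \<Longrightarrow> i \<in> I"
  using strings by blast

lemma average_minus: "T x - x = (\<Sum>t=1..E. \<omega> t *\<^sub>R (U t x - x))"
  by (simp add: string_average_def scaleR_diff_right sum_subtractf \<omega>_sum
      del: One_nat_def flip: scaleR_sum_left)

lemma string_sum_nonneg: "t \<in> {1..E} \<Longrightarrow> 0 \<le> string_sum Ts \<alpha> (str t) x"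
  by (rule order_trans[OF _ string_sum_lower_bounds(1)]) (use \<alpha> mem_I in auto)

lemma string_sum_le_total:
  assumes "t \<in> {1..E}"
  shows "\<omega> t * string_sum Ts \<alpha> (str t) x \<le> total x"
  unfolding total_def
  using assms \<omega>_nonneg string_sum_nonneg
  by (intro member_le_sum[of t "{1..E}" "\<lambda>t. \<omega> t * string_sum Ts \<alpha> (str t) x"])
    (auto intro!: mult_nonneg_nonneg)

lemma total_le_inner:
  assumes "z \<in> (\<Inter>i\<in>I. Fix (Ts i))"
  shows "total x \<le> inner (z - x) (T x - x)"
proof -
  have "total x \<le> (\<Sum>t=1..E. \<omega> t * inner (z - x) (U t x - x))"
    unfolding total_def
    by (intro sum_mono mult_left_mono string_sum_le_inner)
      (use assms cutter \<alpha> mem_I \<omega>_nonneg in auto)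
  also have "\<dots> = inner (z - x) (T x - x)"
    unfolding average_minus by (simp add: inner_sum_right)
  finally show ?thesis .
qed

text \<open>Convexity of the squared norm reduces this to the lower bound for each string.\<close>

lemma total_ge_average: "(norm (T x - x))\<^sup>2 / 2 \<le> total x"
proof -
  have "(norm (T x - x))\<^sup>2 \<le> (\<Sum>t=1..E. \<omega> t * (norm (U t x - x))\<^sup>2)"
    unfolding average_minus using \<omega>_nonneg \<omega>_sum
    by (intro norm_sq_weighted_sum_le) auto
  also have "\<dots> \<le> (\<Sum>t=1..E. \<omega> t * (2 * string_sum Ts \<alpha> (str t) x))"
  proof (intro sum_mono mult_left_mono)
    fix t assume "t \<in> {1..E}"
    then show "(norm (U t x - x))\<^sup>2 \<le> 2 * string_sum Ts \<alpha> (str t) x"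
      using string_sum_lower_bounds(1)[of "str t" \<alpha> Ts x] \<alpha> mem_I by simp
  qed (use \<omega>_nonneg in auto)
  also have "\<dots> = 2 * total x" unfolding total_def by (simp add: sum_distrib_left mult_ac)
  finally show ?thesis by simp
qed

lemma total_nonneg: "0 \<le> total x"
  by (rule order_trans[OF _ total_ge_average]) simp

text \<open>This removes the case distinction in \<open>sigma_max\<close>: on \<open>Fix T\<close>
  the upper bound \<open>total_le_inner\<close> and the lower bound \<open>total_ge_average\<close>
  force \<open>total x = 0\<close>.\<close>

lemma sigma_max_times: "\<sigma> x * (norm (T x - x))\<^sup>2 = total x"
proof (cases "x \<in> Fix T")
  case True
  then have "T x - x = 0" by (simp add: Fix_def)
  moreover obtain z where "z \<in> (\<Inter>i\<in>I. Fix (Ts i))" using common_fixed_point by blast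
  ultimately have "total x = 0" using total_le_inner[of z x] total_ge_average[of x] by simp
  then show ?thesis using \<open>T x - x = 0\<close> by simp
next
  case False
  then have "T x - x \<noteq> 0" by (simp add: Fix_def)
  then show ?thesis using False by (simp add: sigma_max_def total_def string_sum_def)
qed

lemma sigma_max_ge: "1 / 2 \<le> \<sigma> x"
proof (cases "x \<in> Fix T")
  case True
  then show ?thesis by (simp add: sigma_max_def)
next
  case False
  then have "0 < (norm (T x - x))\<^sup>2" by (simp add: Fix_def)
  moreover have "1 / 2 * (norm (T x - x))\<^sup>2 \<le> \<sigma> x * (norm (T x - x))\<^sup>2"
    using total_ge_average[of x] by (simp add: sigma_max_times)
  ultimately show ?thesis by (simp only: mult_le_cancel_right_pos)
qed

lemma norm_sq_extrapolated_step: "(norm (\<sigma> x *\<^sub>R (T x - x)))\<^sup>2 = \<sigma> x * total x"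
  by (simp add: power_mult_distrib power2_eq_square[of "\<sigma> x"] flip: sigma_max_times)

lemma total_le_extrapolated_step: "total x \<le> 2 * (norm (\<sigma> x *\<^sub>R (T x - x)))\<^sup>2"
proof -
  have "1 / 2 * total x \<le> \<sigma> x * total x"
    by (intro mult_right_mono sigma_max_ge total_nonneg)
  then show ?thesis unfolding norm_sq_extrapolated_step by simp
qed

text \<open>With \<open>v\<close> the extrapolated step,
  \<open>(norm v)\<^sup>2 = \<sigma> x * total x\<close> is at most \<open>inner (z - x) v\<close>,
  the cutter inequality with parameter 1. Expanding the square for a relaxation \<open>l\<close>
  then gives the decrease.\<close>

lemma extrapolated_relaxation_fejer:
  assumes z: "z \<in> (\<Inter>i\<in>I. Fix (Ts i))" and l: "0 \<le> l"
  shows "(norm (x + (l * \<sigma> x) *\<^sub>R (T x - x) - z))\<^sup>2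
    \<le> (norm (x - z))\<^sup>2 - l * (2 - l) * (norm (\<sigma> x *\<^sub>R (T x - x)))\<^sup>2"
proof -
  define v where "v = \<sigma> x *\<^sub>R (T x - x)"
  have "\<sigma> x * total x \<le> \<sigma> x * inner (z - x) (T x - x)"
    using total_le_inner[OF z] sigma_max_ge[of x] by (intro mult_left_mono) auto
  then have "(norm v)\<^sup>2 \<le> inner (z - x) v"
    unfolding v_def norm_sq_extrapolated_step by simp
  then have "l * (norm v)\<^sup>2 \<le> l * inner (z - x) v" using l by (rule mult_left_mono)
  moreover have "(norm (x + l *\<^sub>R v - z))\<^sup>2
      = (norm (x - z))\<^sup>2 - 2 * (l * inner (z - x) v) + l\<^sup>2 * (norm v)\<^sup>2"
    by (simp add: power2_norm_eq_inner algebra_simps inner_simps inner_commute power2_eq_square[of l])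
  ultimately have "(norm (x + l *\<^sub>R v - z))\<^sup>2
      \<le> (norm (x - z))\<^sup>2 - 2 * (l * (norm v)\<^sup>2) + l\<^sup>2 * (norm v)\<^sup>2"
    by linarith
  then show ?thesis by (simp add: v_def algebra_simps power2_eq_square[of l])
qed

section \<open>Consequences of a vanishing numerator, and fixed points\<close>

text \<open>By the lower bounds for strings and averages, \<open>total\<close> dominates a fixed
  positive multiple of each squared norm in question.\<close>

lemma
  assumes total: "(\<lambda>k. total (u k)) \<longlonglongrightarrow> 0"
  shows average_tendsto: "(\<lambda>k. T (u k) - u k) \<longlonglongrightarrow> 0"
    and string_op_tendsto: "t \<in> {1..E} \<Longrightarrow> (\<lambda>k. U t (u k) - u k) \<longlonglongrightarrow> 0"
    and string_step_tendsto: "t \<in> {1..E} \<Longrightarrow> j \<in> {1..length (str t)} \<Longrightarrow>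
      (\<lambda>k. string_step Ts (str t) j (u k)) \<longlonglongrightarrow> 0"
proof -
  have squeeze: "g \<longlonglongrightarrow> 0" if c: "0 < c" "\<And>k. c * (norm (g k))\<^sup>2 \<le> total (u k)"
    for c and g :: "nat \<Rightarrow> 'h"
  proof -
    have "(\<lambda>k. (norm (g k))\<^sup>2) \<longlonglongrightarrow> 0"
    proof (rule tendsto_sandwich[OF always_eventually always_eventually tendsto_const])
      show "(\<lambda>k. total (u k) / c) \<longlonglongrightarrow> 0" using tendsto_divide[OF total tendsto_const, of c] c(1) by simp
      show "\<forall>k. (norm (g k))\<^sup>2 \<le> total (u k) / c" using c by (simp add: field_simps)
    qed auto
    then have "(\<lambda>k. sqrt ((norm (g k))\<^sup>2)) \<longlonglongrightarrow> sqrt 0" by (rule tendsto_real_sqrt)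
    then show ?thesis by (simp add: tendsto_norm_zero_iff)
  qed
  show "(\<lambda>k. T (u k) - u k) \<longlonglongrightarrow> 0"
    by (rule squeeze[of "1 / 2"]) (use total_ge_average in auto)
  assume t: "t \<in> {1..E}"
  have \<alpha>_t: "0 < \<alpha> i \<and> \<alpha> i < 2" if "i \<in> set (str t)" for i using \<alpha> mem_I t that by blast
  have le: "\<omega> t * a \<le> total x" if "a \<le> string_sum Ts \<alpha> (str t) x" for a x
    using mult_left_mono[OF that, of "\<omega> t"] string_sum_le_total[OF t] \<omega>_pos[OF t]
    by (meson less_imp_le order_trans)
  show "(\<lambda>k. U t (u k) - u k) \<longlonglongrightarrow> 0"
    using le[OF string_sum_lower_bounds(1)] \<alpha>_t \<omega>_pos[OF t]
    by (intro squeeze[of "\<omega> t / 2"]) auto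
  assume j: "j \<in> {1..length (str t)}"
  have "str t ! (j - 1) \<in> set (str t)" using j by (intro nth_mem) auto
  then have "0 < 1 / \<alpha> (str t ! (j - 1)) - 1 / 2" using \<alpha>_t by (simp add: field_simps)
  then show "(\<lambda>k. string_step Ts (str t) j (u k)) \<longlonglongrightarrow> 0"
    using le[OF string_sum_lower_bounds(2)[OF _ j]] \<alpha>_t \<omega>_pos[OF t]
    by (intro squeeze[of "\<omega> t * (1 / \<alpha> (str t ! (j - 1)) - 1 / 2)"]) (auto simp: mult.assoc)
qed

lemma string_partial_tendsto:
  assumes total: "(\<lambda>k. total (u k)) \<longlonglongrightarrow> 0" and t: "t \<in> {1..E}"
  shows "j \<le> length (str t) \<Longrightarrow> (\<lambda>k. string_partial Ts (str t) j (u k) - u k) \<longlonglongrightarrow> 0"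
proof (induction j)
  case (Suc j)
  have "(\<lambda>k. string_step Ts (str t) (Suc j) (u k) + (string_partial Ts (str t) j (u k) - u k))
      \<longlonglongrightarrow> 0 + 0"
    using Suc by (intro tendsto_add string_step_tendsto[OF total t]) auto
  then show ?case by (simp add: string_step_def)
qed (simp add: string_partial_0)

lemma index_in_string:
  assumes "i \<in> I"
  obtains t j where "t \<in> {1..E}" "j < length (str t)" "str t ! j = i"
  using assms unfolding strings[symmetric] by (auto simp: in_set_conv_nth)

text \<open>If \<open>T x = x\<close>, then \<open>total x = 0\<close>, and the asymptotic
  statements applied to the constant sequence \<open>x\<close> show that every partial composition
  fixes \<open>x\<close>; each index occurs in some string, so each \<open>Ts i\<close> fixes
  \<open>x\<close>. Conversely, a common fixed point inserted for \<open>z\<close> in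
  \<open>total_le_inner\<close> at itself gives \<open>total x \<le> 0\<close>.\<close>

lemma Fix_average: "Fix T = (\<Inter>i\<in>I. Fix (Ts i))"
proof
  show "Fix T \<subseteq> (\<Inter>i\<in>I. Fix (Ts i))"
  proof (intro subsetI INT_I)
    fix x i assume "x \<in> Fix T" "i \<in> I"
    then have total: "(\<lambda>k. total x) \<longlonglongrightarrow> 0"
      by (simp add: Fix_def flip: sigma_max_times)
    obtain t j where tj: "t \<in> {1..E}" "j < length (str t)" "str t ! j = i"
      using index_in_string[OF \<open>i \<in> I\<close>] .
    have "string_partial Ts (str t) j' x = x" if "j' \<le> length (str t)" for j'
      using string_partial_tendsto[OF total tj(1) that] by (simp add: LIMSEQ_const_iff)
    then show "x \<in> Fix (Ts i)"
      using string_partial_Suc[OF tj(2), of Ts x] tj by (simp add: Fix_def)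
  qed
  show "(\<Inter>i\<in>I. Fix (Ts i)) \<subseteq> Fix T"
  proof
    fix x assume "x \<in> (\<Inter>i\<in>I. Fix (Ts i))"
    then have "total x \<le> 0" using total_le_inner[of x x] by simp
    then have "(norm (T x - x))\<^sup>2 \<le> 0" using total_ge_average[of x] by linarith
    then show "x \<in> Fix T" by (simp add: Fix_def)
  qed
qed

lemma demiclosed_limit_in_Fix:
  assumes total: "(\<lambda>k. total (u k)) \<longlonglongrightarrow> 0" and y: "weakly_converges u y"
    and "demiclosed_at_0 (\<lambda>v. T v - v)
         \<or> (\<forall>t\<in>{1..E}. demiclosed_at_0 (\<lambda>v. U t v - v))
         \<or> (\<forall>i\<in>I. demiclosed_at_0 (\<lambda>v. Ts i v - v))"
  shows "y \<in> Fix T"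
  using assms(3)
proof (elim disjE)
  assume "demiclosed_at_0 (\<lambda>v. T v - v)"
  then have "T y - y = 0"
    using y average_tendsto[OF total] unfolding demiclosed_at_0_def by blast
  then show ?thesis by (simp add: Fix_def)
next
  assume *: "\<forall>t\<in>{1..E}. demiclosed_at_0 (\<lambda>v. U t v - v)"
  have "U t y - y = 0" if "t \<in> {1..E}" for t
    using * that y string_op_tendsto[OF total that] unfolding demiclosed_at_0_def by blast
  then have "T y - y = 0" unfolding average_minus by simp
  then show ?thesis by (simp add: Fix_def)
next
  assume *: "\<forall>i\<in>I. demiclosed_at_0 (\<lambda>v. Ts i v - v)"
  have "y \<in> Fix (Ts i)" if i: "i \<in> I" for i
  proof -
    obtain t j where tj: "t \<in> {1..E}" "j < length (str t)" "str t ! j = i"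
      using index_in_string[OF i] .
    \<comment> \<open>The shifted sequence to which demi-closedness of \<open>Ts i\<close> applies:
      it has the same weak limit as \<open>u\<close>, and its displacement under \<open>Ts i\<close>
      is step \<open>j + 1\<close> of the string, because list positions start at 0 and steps at
      1.\<close>
    let ?w = "\<lambda>k. string_partial Ts (str t) j (u k)"
    have "weakly_converges ?w y"
      using weakly_converges_strongly_close[OF y string_partial_tendsto[OF total tj(1)]] tj(2)
      by simp
    moreover have "(\<lambda>k. Ts i (?w k) - ?w k) \<longlonglongrightarrow> 0"
      using string_step_tendsto[OF total tj(1), of "Suc j"] tj(2,3)
      by (simp add: string_step_def string_partial_Suc)
    ultimately have "Ts i y - y = 0" using * i unfolding demiclosed_at_0_def by blast
    then show ?thesis by (simp add: Fix_def)
  qed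
  then show ?thesis unfolding Fix_average by blast
qed

section \<open>Convergence of the iteration\<close>

text \<open>Both \<open>relax k\<close> and \<open>2 - relax k\<close> are at least
  \<open>\<epsilon>\<close>, which yields the factor \<open>\<epsilon>\<^sup>2\<close>; the 1/2
  comes from \<open>total_le_extrapolated_step\<close>.\<close>

lemma extrapolated_iteration_fejer:
  assumes \<epsilon>: "0 < \<epsilon>" and relax: "\<And>k. \<epsilon> \<le> relax k \<and> relax k \<le> 2 - \<epsilon>"
    and iter: "\<And>k. x (Suc k) = x k + (relax k * \<sigma> (x k)) *\<^sub>R (T (x k) - x k)"
    and z: "z \<in> Fix T"
  shows "(norm (x (Suc k) - z))\<^sup>2 \<le> (norm (x k - z))\<^sup>2 - \<epsilon>\<^sup>2 / 2 * total (x k)"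
proof -
  let ?v = "\<sigma> (x k) *\<^sub>R (T (x k) - x k)"
  have "\<epsilon>\<^sup>2 / 2 * total (x k) \<le> \<epsilon>\<^sup>2 * (norm ?v)\<^sup>2"
    using mult_left_mono[OF total_le_extrapolated_step[of "x k"], of "\<epsilon>\<^sup>2 / 2"] by simp
  also have "\<dots> \<le> relax k * (2 - relax k) * (norm ?v)\<^sup>2"
    unfolding power2_eq_square[of \<epsilon>]
    using relax[of k] \<epsilon> by (intro mult_right_mono mult_mono) auto
  finally show ?thesis
    using extrapolated_relaxation_fejer[of z "relax k" "x k"] z relax[of k] \<epsilon>
    unfolding iter[symmetric] Fix_average by simp
qed

text \<open>The squared distances to a fixed point decrease and hence converge, so their consecutive
  differences, which bound \<open>total\<close> up to a constant, tend to 0.\<close>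

lemma total_iteration_tendsto:
  assumes \<epsilon>: "0 < \<epsilon>" and relax: "\<And>k. \<epsilon> \<le> relax k \<and> relax k \<le> 2 - \<epsilon>"
    and iter: "\<And>k. x (Suc k) = x k + (relax k * \<sigma> (x k)) *\<^sub>R (T (x k) - x k)"
  shows "(\<lambda>k. total (x k)) \<longlonglongrightarrow> 0"
proof -
  obtain z where z: "z \<in> Fix T" using common_fixed_point unfolding Fix_average by blast
  let ?d = "\<lambda>k. (norm (x k - z))\<^sup>2"
  have step: "?d (Suc k) \<le> ?d k - \<epsilon>\<^sup>2 / 2 * total (x k)" for k
    by (rule extrapolated_iteration_fejer[where x=x and relax=relax, OF assms z])
  have "0 \<le> \<epsilon>\<^sup>2 / 2 * total (x k)" for k using total_nonneg by simp
  then have "decseq ?d" using step 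
    by (intro decseq_SucI) (smt (verit))
  then obtain l where l: "?d \<longlonglongrightarrow> l" using decseq_convergent[of ?d 0] by auto
  have "(\<lambda>k. 2 / \<epsilon>\<^sup>2 * (?d k - ?d (Suc k))) \<longlonglongrightarrow> 2 / \<epsilon>\<^sup>2 * (l - l)"
    by (intro tendsto_intros l LIMSEQ_Suc[OF l])
  then have lim: "(\<lambda>k. 2 / \<epsilon>\<^sup>2 * (?d k - ?d (Suc k))) \<longlonglongrightarrow> 0" by simp
  have "total (x k) \<le> 2 / \<epsilon>\<^sup>2 * (?d k - ?d (Suc k))" for k
    using step[of k] \<epsilon> by (simp add: field_simps)
  then show ?thesis
    using total_nonneg by (intro tendsto_sandwich[OF _ _ tendsto_const lim]) auto
qed

end

theorem theorem3p7:
  fixes Ts :: "nat \<Rightarrow> 'h::{real_inner, complete_space} \<Rightarrow> 'h"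
    and \<alpha> :: "nat \<Rightarrow> real"
    and m E :: nat
    and str :: "nat \<Rightarrow> nat list"
    and \<omega> :: "nat \<Rightarrow> real"
    and \<epsilon> :: real
    and relax :: "nat \<Rightarrow> real"
    and x :: "nat \<Rightarrow> 'h"
  defines "U \<equiv> \<lambda>t. string_op Ts (str t)"
    and "T \<equiv> string_average Ts str \<omega> E"
    and "\<sigma> \<equiv> sigma_max Ts \<alpha> str \<omega> E"
  assumes "\<And>i. i \<in> {1..m} \<Longrightarrow> 0 < \<alpha> i \<and> \<alpha> i < 2"
    and "\<And>i. i \<in> {1..m} \<Longrightarrow> relaxed_cutter (\<alpha> i) (Ts i)"
    and "(\<Inter>i\<in>{1..m}. Fix (Ts i)) \<noteq> {}"
    and "\<And>t. t \<in> {1..E} \<Longrightarrow> distinct (str t)"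
    and "(\<Union>t\<in>{1..E}. set (str t)) = {1..m}"
    and "\<And>t. t \<in> {1..E} \<Longrightarrow> 0 < \<omega> t"
    and "(\<Sum>t=1..E. \<omega> t) = 1"
    and "0 < \<epsilon>" and "\<epsilon> < 1"
    and "\<And>k. \<epsilon> \<le> relax k \<and> relax k \<le> 2 - \<epsilon>"
    and "\<And>k. x (Suc k) = x k + (relax k * \<sigma> (x k)) *\<^sub>R (T (x k) - x k)"
    and "demiclosed_at_0 (\<lambda>v. T v - v)
         \<or> (\<forall>t\<in>{1..E}. demiclosed_at_0 (\<lambda>v. U t v - v))
         \<or> (\<forall>i\<in>{1..m}. demiclosed_at_0 (\<lambda>v. Ts i v - v))"
  shows "\<exists>y\<in>Fix T. weakly_converges x y"
proof -
  interpret string_averaging Ts \<alpha> "{1..m}" E str \<omega>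
    by unfold_locales (fact assms)+
  note iter = assms(14)[unfolded T_def \<sigma>_def]
  have total: "(\<lambda>k. total (x k)) \<longlonglongrightarrow> 0"
    by (rule total_iteration_tendsto[where relax=relax, OF assms(11,13) iter])
  show ?thesis
  proof (rule fejer_monotone_weakly_converges)
    show "Fix T \<noteq> {}" using common_fixed_point unfolding T_def Fix_average .
  next
    fix z k assume z: "z \<in> Fix T"
    have "0 \<le> \<epsilon>\<^sup>2 / 2 * total (x k)" using total_nonneg by simp
    then have "(norm (x (Suc k) - z))\<^sup>2 \<le> (norm (x k - z))\<^sup>2"
      using extrapolated_iteration_fejer
          [where x=x and relax=relax, OF assms(11,13) iter z[unfolded T_def], of k]
      by linarith
    then show "norm (x (Suc k) - z) \<le> norm (x k - z)" by simp
  next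
    fix r y assume r: "strict_mono r" "weakly_converges (x \<circ> r) y"
    then show "y \<in> Fix T"
      using demiclosed_limit_in_Fix[of "x \<circ> r" y] LIMSEQ_subseq_LIMSEQ[OF total r(1)] assms(15)
      unfolding T_def U_def by (simp add: o_def)
  qed
qed

end
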